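(* Let $\Omega$ be the chair tiling space in its arrow version, with the action of $G=O(2,\mathbb{Z})$. Let $H_1=G$; let $H_2\cong\mathbb{Z}_4$ be the subgroup of rotations in $G$; let $H_3\cong\mathbb{Z}_2$ be generated by rotation by 180 degrees; let $H_4$ be generated by the reflections about the $x$ axis and about the $y$ axis; and let $H_9$ be generated by the reflections about the lines $y=x$ and $y=-x$. For $H\le G$ let $\Omega_H=\{T\in\Omega: hT=T \text{ for all } h\in H\}$. Then $\Omega_{H_1}=\Omega_{H_2}=\Omega_{H_3}=\Omega_{H_4}=\Omega_{H_9}$, and this set consists of exactly one tiling, namely the fixed point of the substitution whose four tiles touching the origin have arrows all pointing away from the origin (northeast in the first quadrant, northwest in the second, southwest in the third, southeast in the fourth).
   Context: Arrow version of the chair tiling: the tiles are closed unit squares with sides parallel to the coordinate axes, meeting full edge to full edge, each labeled by an arrow pointing NE, NW, SW or SE. The substitution $\sigma$ scales a tile linearly by 2 about the origin and replaces the resulting $2\times 2$ square by four labeled unit squares. For an NE tile the four labels are: top-left SE, top-right NE, bottom-left NE, bottom-right NW. The substitution of the other three tiles is obtained from this one by rotating or reflecting the whole picture (positions and arrows). $\sigma$ extends to patches and tilings tile by tile. $\Omega$ is the set of all such labeled tilings of $\mathbb{R}^2$ (the tile vertices need not lie in $\mathbb{Z}^2$) such that every finite patch is a translate of a subpatch of $\sigma^n(t)$ for some tile $t$ and some $n\ge 0$. $G=O(2,\mathbb{Z})$ is the 8-element dihedral group generated by rotation by 90 degrees about the origin and reflection about the $x$ axis. It acts on $\Omega$ by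 acting on the plane, moving the tiles and transforming their arrows accordingly (for example, the counterclockwise rotation by 90 degrees sends an NE arrow to an NW arrow, and reflection about the $x$ axis interchanges NE with SE and NW with SW). *)

theory Defs
  imports "HOL-Analysis.Analysis" "HOL-Algebra.Generated_Groups"
begin

section \<open>The group \<open>O(2,\<int>)\<close> and its subgroups\<close>

definition mat2 :: "real \<Rightarrow> real \<Rightarrow> real \<Rightarrow> real \<Rightarrow> real^2^2" where
  "mat2 a b c d = vector [vector [a, b], vector [c, d]]"

definition O2Z :: "(real^2^2) monoid" where
  "O2Z = \<lparr>carrier = {A. orthogonal_matrix A \<and> (\<forall>i j. A $ i $ j \<in> \<int>)},
          monoid.mult = (**), one = mat 1\<rparr>"

definition rot90 :: "real^2^2" where "rot90 = mat2 0 (-1) 1 0"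
definition rot180 :: "real^2^2" where "rot180 = mat2 (-1) 0 0 (-1)"
definition refl_x_axis :: "real^2^2" where "refl_x_axis = mat2 1 0 0 (-1)"
definition refl_y_axis :: "real^2^2" where "refl_y_axis = mat2 (-1) 0 0 1"
definition refl_diag :: "real^2^2" where "refl_diag = mat2 0 1 1 0"
definition refl_antidiag :: "real^2^2" where "refl_antidiag = mat2 0 (-1) (-1) 0"

definition H1 :: "(real^2^2) set" where "H1 = carrier O2Z"
definition H2 :: "(real^2^2) set" where "H2 = {A \<in> carrier O2Z. rotation_matrix A}"
definition H3 :: "(real^2^2) set" where "H3 = generate O2Z {rot180}"
definition H4 :: "(real^2^2) set" where "H4 = generate O2Z {refl_x_axis, refl_y_axis}"
definition H9 :: "(real^2^2) set" where "H9 = generate O2Z {refl_diag, refl_antidiag}"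


section \<open>Arrow tiles\<close>

datatype arrow = NE | NW | SW | SE

fun dir :: "arrow \<Rightarrow> real^2" where
  "dir NE = vector [1, 1]"
| "dir NW = vector [-1, 1]"
| "dir SW = vector [-1, -1]"
| "dir SE = vector [1, -1]"

text \<open>A labeled unit square is represented by its centre and its arrow. With centres (rather than,
  say, lower left corners) a linear isometry acts on the position simply by matrix multiplication;
  see \<open>support_act_tile\<close> below.\<close>

type_synonym tile = "(real^2) \<times> arrow"

definition support :: "tile \<Rightarrow> (real^2) set" where
  "support t = cbox (fst t - vector [1/2, 1/2]) (fst t + vector [1/2, 1/2])"

definition act_arrow :: "real^2^2 \<Rightarrow> arrow \<Rightarrow> arrow" where
  "act_arrow A a = (THE b. dir b = A *v dir a)"

definition act_tile :: "real^2^2 \<Rightarrow> tile \<Rightarrow> tile" where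
  "act_tile A t = (A *v fst t, act_arrow A (snd t))"

definition act :: "real^2^2 \<Rightarrow> tile set \<Rightarrow> tile set" where
  "act A P = act_tile A ` P"

definition translate :: "real^2 \<Rightarrow> tile set \<Rightarrow> tile set" where
  "translate v P = (\<lambda>(c, a). (v + c, a)) ` P"


section \<open>The substitution\<close>

text \<open>\<open>ne_child q\<close> is the label of the unit square in the corner \<open>q\<close> of the \<open>2 \<times> 2\<close> square
  which replaces an NE tile, e.g. \<open>q = NW\<close> is the top left corner.\<close>

fun ne_child :: "arrow \<Rightarrow> arrow" where
  "ne_child NW = SE"
| "ne_child NE = NE"
| "ne_child SW = NE"
| "ne_child SE = NW"

text \<open>If \<open>A\<close> carries the NE arrow to \<open>a\<close>, the substitution of an \<open>a\<close> tile is the image of the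
  picture for NE under \<open>A\<close>. The two such \<open>A\<close> yield the same picture; see \<open>subst_tile_NE\<close> and the
  lemmas following it below.\<close>

definition subst_tile :: "tile \<Rightarrow> tile set" where
  "subst_tile t = {(2 *\<^sub>R fst t + (1/2) *\<^sub>R dir (act_arrow A q), act_arrow A (ne_child q)) | A q.
      A \<in> carrier O2Z \<and> act_arrow A NE = snd t}"

definition subst :: "tile set \<Rightarrow> tile set" where
  "subst P = (\<Union>t\<in>P. subst_tile t)"


section \<open>The tiling space\<close>

text \<open>For axis-parallel unit squares, meeting full edge to full edge is the condition that
  different tiles do not overlap and intersect in a common (possibly empty) face.\<close>

definition is_tiling :: "tile set \<Rightarrow> bool" where
  "is_tiling T \<longleftrightarrow>
     (\<Union>t\<in>T. support t) = UNIV \<and>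
     (\<forall>s\<in>T. \<forall>t\<in>T. s \<noteq> t \<longrightarrow>
        interior (support s) \<inter> interior (support t) = {} \<and>
        (support s \<inter> support t) face_of support s \<and>
        (support s \<inter> support t) face_of support t)"

definition Omega :: "tile set set" where
  "Omega = {T. is_tiling T \<and>
     (\<forall>P. finite P \<and> P \<subseteq> T \<longrightarrow>
        (\<exists>t n v Q. Q \<subseteq> (subst ^^ n) {t} \<and> P = translate v Q))}"

definition fixed_tilings :: "(real^2^2) set \<Rightarrow> tile set set" where
  "fixed_tilings H = {T \<in> Omega. \<forall>h\<in>H. act h T = T}"

definition touching_origin :: "tile set \<Rightarrow> tile set" where
  "touching_origin T = {t \<in> T. 0 \<in> support t}"

definition outward_star :: "tile set" where
  "outward_star = {(vector [1/2, 1/2], NE), (vector [-1/2, 1/2], NW),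
                   (vector [-1/2, -1/2], SW), (vector [1/2, -1/2], SE)}"


section \<open>Basic facts\<close>

lemma mat2_nth [simp]:
  "mat2 a b c d $ 1 $ 1 = a" "mat2 a b c d $ 1 $ 2 = b"
  "mat2 a b c d $ 2 $ 1 = c" "mat2 a b c d $ 2 $ 2 = d"
  by (simp_all add: mat2_def)

lemma mat2_eq_iff: "mat2 a b c d = mat2 a' b' c' d' \<longleftrightarrow> a = a' \<and> b = b' \<and> c = c' \<and> d = d'"
  by (simp add: vec_eq_iff forall_2)

lemma mat2_mult: "mat2 a b c d ** mat2 a' b' c' d' =
    mat2 (a*a' + b*c') (a*b' + b*d') (c*a' + d*c') (c*b' + d*d')"
  by (simp add: vec_eq_iff forall_2 matrix_matrix_mult_def sum_2)

lemma mat2_vector: "mat2 a b c d *v vector [x, y] = vector [a*x + b*y, c*x + d*y]"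
  by (simp add: vec_eq_iff forall_2 matrix_vector_mult_def sum_2)

lemma mat_1_mat2: "(mat 1 :: real^2^2) = mat2 1 0 0 1"
  by (simp add: vec_eq_iff forall_2 mat_def)

lemma vector2_eq_iff: "(vector [x, y] :: real^2) = vector [x', y'] \<longleftrightarrow> x = x' \<and> y = y'"
  by (simp add: vec_eq_iff forall_2)

lemma dir_eq_iff: "dir a = dir b \<longleftrightarrow> a = b"
  by (cases a; cases b) (simp_all add: vector2_eq_iff)

lemma act_arrow_eqI: "dir b = A *v dir a \<Longrightarrow> act_arrow A a = b"
  unfolding act_arrow_def by (rule the_equality) (auto simp flip: dir_eq_iff)

lemmas O2Z_mats = rot90_def rot180_def refl_x_axis_def refl_y_axis_def refl_diag_def
  refl_antidiag_def

lemma carrier_O2Z: "carrier O2Z =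
    {mat2 1 0 0 1, rot90, rot180, mat2 0 1 (-1) 0,
     refl_x_axis, refl_y_axis, refl_diag, refl_antidiag}" (is "_ = ?S")
proof
  show "carrier O2Z \<subseteq> ?S"
  proof
    fix A assume A: "A \<in> carrier O2Z"
    have o: "transpose A ** A = mat 1" and o': "A ** transpose A = mat 1"
      and i: "\<And>i j. A $ i $ j \<in> \<int>"
      using A by (auto simp: O2Z_def orthogonal_matrix_def)
    obtain a b c d where abcd: "A $ 1 $ 1 = of_int a" "A $ 1 $ 2 = of_int b"
        "A $ 2 $ 1 = of_int c" "A $ 2 $ 2 = of_int d"
      using i by (metis Ints_cases)
    have AA: "A = mat2 a b c d"
      by (simp add: vec_eq_iff forall_2 abcd)
    have tr: "transpose A = mat2 a c b d"
      by (simp add: vec_eq_iff forall_2 abcd transpose_def)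
    have "real_of_int (a*a + b*b) = of_int 1" "real_of_int (c*c + d*d) = of_int 1"
         "real_of_int (a*c + b*d) = of_int 0"
      using o' unfolding tr unfolding AA mat_1_mat2 mat2_mult mat2_eq_iff by auto
    then have e: "a*a + b*b = 1" "c*c + d*d = 1" "a*c + b*d = 0"
      by (simp_all only: of_int_eq_iff)
    have *: "x \<in> {-1, 0, 1}" if "x*x + y*y = 1" for x y :: int
    proof -
      have "x*x \<le> 1" using that zero_le_square[of y] by linarith
      then have "\<bar>x\<bar> \<le> 1" by (metis abs_square_le_1 power2_eq_square)
      then show ?thesis by auto
    qed
    have "a \<in> {-1,0,1}" "b \<in> {-1,0,1}" "c \<in> {-1,0,1}" "d \<in> {-1,0,1}"
      using *[of a b] *[of b a] *[of c d] *[of d c] e by (simp_all add: add.commute)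
    then show "A \<in> ?S"
      using e unfolding AA O2Z_mats
      by (elim insertE emptyE; simp add: mat2_eq_iff)
  qed
  have "transpose (mat2 a b c d) = mat2 a c b d" for a b c d
    by (simp add: vec_eq_iff forall_2 transpose_def)
  then show "?S \<subseteq> carrier O2Z"
    by (auto simp: O2Z_def orthogonal_matrix_def forall_2 mat_1_mat2 mat2_mult rot90_def
        rot180_def refl_x_axis_def refl_y_axis_def refl_diag_def refl_antidiag_def)
qed

lemma O2Z_group: "group O2Z"
proof (rule groupI)
  fix x y z assume "x \<in> carrier O2Z" "y \<in> carrier O2Z" "z \<in> carrier O2Z"
  then show "x \<otimes>\<^bsub>O2Z\<^esub> y \<otimes>\<^bsub>O2Z\<^esub> z = x \<otimes>\<^bsub>O2Z\<^esub> (y \<otimes>\<^bsub>O2Z\<^esub> z)"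
    by (simp add: O2Z_def matrix_mul_assoc)
next
  fix x y assume "x \<in> carrier O2Z" "y \<in> carrier O2Z"
  then show "x \<otimes>\<^bsub>O2Z\<^esub> y \<in> carrier O2Z"
    using orthogonal_matrix_mul[of x y] by (auto simp: O2Z_def) (auto simp: matrix_matrix_mult_def intro!: Ints_sum)
next
  show "\<one>\<^bsub>O2Z\<^esub> \<in> carrier O2Z"
    by (simp add: O2Z_def orthogonal_matrix_id) (simp add: mat_def)
next
  fix x assume "x \<in> carrier O2Z"
  then show "\<one>\<^bsub>O2Z\<^esub> \<otimes>\<^bsub>O2Z\<^esub> x = x" by (simp add: O2Z_def)
next
  fix x assume x: "x \<in> carrier O2Z"
  then have "transpose x \<in> carrier O2Z" "transpose x \<otimes>\<^bsub>O2Z\<^esub> x = \<one>\<^bsub>O2Z\<^esub>"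
    by (auto simp: O2Z_def orthogonal_matrix_def transpose_def)
  then show "\<exists>y\<in>carrier O2Z. y \<otimes>\<^bsub>O2Z\<^esub> x = \<one>\<^bsub>O2Z\<^esub>" by blast
qed

lemma card_O2Z: "card (carrier O2Z) = 8"
  unfolding carrier_O2Z O2Z_mats by (simp add: mat2_eq_iff)

lemma O2Z_generated: "generate O2Z {rot90, refl_x_axis} = carrier O2Z" (is "?L = _")
proof
  interpret group O2Z by (rule O2Z_group)
  show "?L \<subseteq> carrier O2Z"
    by (rule generate_incl) (simp add: carrier_O2Z)
  have m: "x \<otimes>\<^bsub>O2Z\<^esub> y = x ** y" for x y by (simp add: O2Z_def)
  have r: "rot90 \<in> ?L" and s: "refl_x_axis \<in> ?L" by (auto intro: generate.incl)
  have mul: "x ** y \<in> ?L" if "x \<in> ?L" "y \<in> ?L" for x y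
    using generate.eng[OF that] by (simp add: m)
  have 1: "mat2 1 0 0 1 \<in> ?L"
    using generate.one[of O2Z] by (simp add: O2Z_def mat_1_mat2)
  have 2: "rot180 \<in> ?L" using mul[OF r r] by (simp add: O2Z_mats mat2_mult)
  have 3: "mat2 0 1 (-1) 0 \<in> ?L" using mul[OF 2 r] by (simp add: O2Z_mats mat2_mult)
  have 4: "refl_y_axis \<in> ?L" using mul[OF 2 s] by (simp add: O2Z_mats mat2_mult)
  have 5: "refl_diag \<in> ?L" using mul[OF r s] by (simp add: O2Z_mats mat2_mult)
  have 6: "refl_antidiag \<in> ?L" using mul[OF 2 5] by (simp add: O2Z_mats mat2_mult)
  show "carrier O2Z \<subseteq> ?L" unfolding carrier_O2Z using 1 2 3 4 5 6 r s by blast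
qed

lemma Collect_insert_if: "{x \<in> insert a S. P x} = (if P a then insert a {x \<in> S. P x} else {x \<in> S. P x})"
  by auto

lemma H2_eq: "H2 = {mat2 1 0 0 1, rot90, rot180, mat2 0 1 (-1) 0}"
proof -
  have "rotation_matrix A \<longleftrightarrow> det A = 1" if "A \<in> carrier O2Z" for A
    using that by (auto simp: O2Z_def rotation_matrix_def)
  then have "H2 = {A \<in> carrier O2Z. det A = 1}" unfolding H2_def by blast
  then show ?thesis
    unfolding carrier_O2Z by (simp only: Collect_insert_if) (simp add: det_2 O2Z_mats)
qed

lemma act_arrow_rot90:
  "act_arrow rot90 NE = NW" "act_arrow rot90 NW = SW"
  "act_arrow rot90 SW = SE" "act_arrow rot90 SE = NE"
  by (rule act_arrow_eqI; simp add: O2Z_mats mat2_vector)+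

lemma act_arrow_rot180:
  "act_arrow rot180 NE = SW" "act_arrow rot180 NW = SE"
  "act_arrow rot180 SW = NE" "act_arrow rot180 SE = NW"
  by (rule act_arrow_eqI; simp add: O2Z_mats mat2_vector)+

lemma act_arrow_rot270:
  "act_arrow (mat2 0 1 (-1) 0) NE = SE" "act_arrow (mat2 0 1 (-1) 0) NW = NE"
  "act_arrow (mat2 0 1 (-1) 0) SW = NW" "act_arrow (mat2 0 1 (-1) 0) SE = SW"
  by (rule act_arrow_eqI; simp add: mat2_vector)+

lemma act_arrow_id: "act_arrow (mat2 1 0 0 1) a = a"
  by (rule act_arrow_eqI; cases a; simp add: mat2_vector)

lemma act_arrow_refl_x_axis:
  "act_arrow refl_x_axis NE = SE" "act_arrow refl_x_axis NW = SW"
  "act_arrow refl_x_axis SW = NW" "act_arrow refl_x_axis SE = NE"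
  by (rule act_arrow_eqI; simp add: O2Z_mats mat2_vector)+

lemma act_arrow_refl_y_axis:
  "act_arrow refl_y_axis NE = NW" "act_arrow refl_y_axis NW = NE"
  "act_arrow refl_y_axis SW = SE" "act_arrow refl_y_axis SE = SW"
  by (rule act_arrow_eqI; simp add: O2Z_mats mat2_vector)+

lemma act_arrow_refl_diag:
  "act_arrow refl_diag NE = NE" "act_arrow refl_diag NW = SE"
  "act_arrow refl_diag SW = SW" "act_arrow refl_diag SE = NW"
  by (rule act_arrow_eqI; simp add: O2Z_mats mat2_vector)+

lemma act_arrow_refl_antidiag:
  "act_arrow refl_antidiag NE = SW" "act_arrow refl_antidiag NW = NW"
  "act_arrow refl_antidiag SW = NE" "act_arrow refl_antidiag SE = SE"
  by (rule act_arrow_eqI; simp add: O2Z_mats mat2_vector)+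

lemmas act_arrow_simps = act_arrow_rot90 act_arrow_rot180 act_arrow_rot270 act_arrow_id
  act_arrow_refl_x_axis act_arrow_refl_y_axis act_arrow_refl_diag act_arrow_refl_antidiag

lemma subst_tile_alt: "subst_tile t =
    (\<Union>A\<in>{A \<in> carrier O2Z. act_arrow A NE = snd t}.
       \<Union>q\<in>{NE, NW, SW, SE}. {(2 *\<^sub>R fst t + (1/2) *\<^sub>R dir (act_arrow A q), act_arrow A (ne_child q))})"
proof -
  have *: "{NE, NW, SW, SE} = UNIV" by (auto intro: arrow.exhaust)
  show ?thesis unfolding subst_tile_def * by blast
qed

lemma half_dir:
  "(1/2) *\<^sub>R dir NE = vector [1/2, 1/2]" "(1/2) *\<^sub>R dir NW = vector [-1/2, 1/2]"
  "(1/2) *\<^sub>R dir SW = vector [-1/2, -1/2]" "(1/2) *\<^sub>R dir SE = vector [1/2, -1/2]"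
  by (simp_all add: vec_eq_iff forall_2)

lemma O2Z_NE:
  "{A \<in> carrier O2Z. act_arrow A NE = NE} = {mat2 1 0 0 1, refl_diag}"
  "{A \<in> carrier O2Z. act_arrow A NE = NW} = {rot90, refl_y_axis}"
  "{A \<in> carrier O2Z. act_arrow A NE = SW} = {rot180, refl_antidiag}"
  "{A \<in> carrier O2Z. act_arrow A NE = SE} = {mat2 0 1 (-1) 0, refl_x_axis}"
  unfolding carrier_O2Z by (simp_all only: Collect_insert_if) (simp_all add: act_arrow_simps)

lemma subst_tile_NE: "subst_tile (c, NE) =
    {(2 *\<^sub>R c + vector [-1/2, 1/2], SE), (2 *\<^sub>R c + vector [1/2, 1/2], NE),
     (2 *\<^sub>R c + vector [-1/2, -1/2], NE), (2 *\<^sub>R c + vector [1/2, -1/2], NW)}"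
  unfolding subst_tile_alt snd_conv fst_conv O2Z_NE
  by (simp add: act_arrow_simps half_dir del: dir.simps) blast

lemma subst_tile_NW: "subst_tile (c, NW) =
    {(2 *\<^sub>R c + vector [-1/2, 1/2], NW), (2 *\<^sub>R c + vector [1/2, 1/2], SW),
     (2 *\<^sub>R c + vector [-1/2, -1/2], NE), (2 *\<^sub>R c + vector [1/2, -1/2], NW)}"
  unfolding subst_tile_alt snd_conv fst_conv O2Z_NE
  by (simp add: act_arrow_simps half_dir del: dir.simps) blast

lemma subst_tile_SW: "subst_tile (c, SW) =
    {(2 *\<^sub>R c + vector [-1/2, 1/2], SE), (2 *\<^sub>R c + vector [1/2, 1/2], SW),
     (2 *\<^sub>R c + vector [-1/2, -1/2], SW), (2 *\<^sub>R c + vector [1/2, -1/2], NW)}"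
  unfolding subst_tile_alt snd_conv fst_conv O2Z_NE
  by (simp add: act_arrow_simps half_dir del: dir.simps) blast

lemma subst_tile_SE: "subst_tile (c, SE) =
    {(2 *\<^sub>R c + vector [-1/2, 1/2], SE), (2 *\<^sub>R c + vector [1/2, 1/2], SW),
     (2 *\<^sub>R c + vector [-1/2, -1/2], NE), (2 *\<^sub>R c + vector [1/2, -1/2], SE)}"
  unfolding subst_tile_alt snd_conv fst_conv O2Z_NE
  by (simp add: act_arrow_simps half_dir del: dir.simps) blast

lemma support_iff: "x \<in> support (c, a) \<longleftrightarrow>
    c$1 - 1/2 \<le> x$1 \<and> x$1 \<le> c$1 + 1/2 \<and> c$2 - 1/2 \<le> x$2 \<and> x$2 \<le> c$2 + 1/2"
  by (auto simp: support_def mem_box_cart forall_2)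

lemma support_act_tile:
  assumes A: "A \<in> carrier O2Z"
  shows "support (act_tile A t) = (\<lambda>x. A *v x) ` support t"
proof -
  have sub: "(\<lambda>x. B *v x) ` support s \<subseteq> support (act_tile B s)" if "B \<in> carrier O2Z" for B s
  proof (cases s)
    case (Pair c a)
    show ?thesis
      using that unfolding carrier_O2Z Pair act_tile_def
      by (auto simp: support_iff O2Z_mats matrix_vector_mult_def sum_2)
  qed
  have B: "transpose A \<in> carrier O2Z" "A ** transpose A = mat 1" "transpose A ** A = mat 1"
    using A by (auto simp: O2Z_def orthogonal_matrix_def transpose_def)
  have "support (act_tile A t) \<subseteq> (\<lambda>x. A *v x) ` support t"
  proof
    fix y assume "y \<in> support (act_tile A t)"
    then have "transpose A *v y \<in> support (act_tile (transpose A) (act_tile A t))"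
      using sub[OF B(1)] by blast
    moreover have "fst (act_tile (transpose A) (act_tile A t)) = fst t"
      by (simp add: act_tile_def matrix_vector_mul_assoc B)
    ultimately have "transpose A *v y \<in> support t" by (simp add: support_def)
    moreover have "y = A *v (transpose A *v y)"
      by (simp add: matrix_vector_mul_assoc B del: transpose_matrix_vector)
    ultimately show "y \<in> (\<lambda>x. A *v x) ` support t" by blast
  qed
  then show ?thesis using sub[OF A] by blast
qed

end

theory Submission
  imports Defs
begin

text \<open>The children of an \<open>a\<close> tile all point to the centre of their \<open>2 \<times> 2\<close> square, except the one in
  corner \<open>a\<close>, which keeps the arrow \<open>a\<close>. Hence the axis of an arrow alternates like a
  checkerboard, so a tiling that is invariant under the rotation by 180 degrees has a vertex at
  the origin: a tile centred there would have to equal its opposite, and two tiles sharing an edge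
  have different axes. A parent is determined by its children, so the parents of a centrally
  symmetric window are centrally symmetric as well; iterating, the origin is a vertex of the
  supertiles of all levels. The star of supertiles around it is the same on all levels, and it
  must point outward because no other centrally symmetric star of this kind occurs in a supertile.
  Thus the tiling contains all iterates of the outward star, which already cover the plane.
  The argument takes place inside finite patches, so infinite tilings need not be desubstituted.\<close>

section \<open>Arrows and substitution on the integer grid\<close>

fun opp :: "arrow \<Rightarrow> arrow" where
  "opp NE = SW" | "opp NW = SE" | "opp SW = NE" | "opp SE = NW"

definition child :: "arrow \<Rightarrow> arrow \<Rightarrow> arrow" where
  "child a q = (if q = a then a else opp q)"

text \<open>The position of the square with lower left corner \<open>(i, j)\<close> within its \<open>2 \<times> 2\<close> square.\<close>

definition corner :: "int \<Rightarrow> int \<Rightarrow> arrow" where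
  "corner i j = (if even i then if even j then SW else NW else if even j then SE else NE)"

text \<open>Floor division gives the right parent for negative indices too, so one operator serves
  both the supertiles and the four quadrants around the origin.\<close>

definition inflate :: "(int \<Rightarrow> int \<Rightarrow> arrow) \<Rightarrow> int \<Rightarrow> int \<Rightarrow> arrow" where
  "inflate g i j = child (g (i div 2) (j div 2)) (corner i j)"

definition quadrant :: "int \<Rightarrow> int \<Rightarrow> arrow" where
  "quadrant i j = (if i \<ge> 0 then if j \<ge> 0 then NE else SE else if j \<ge> 0 then NW else SW)"

definition ivec :: "int \<Rightarrow> int \<Rightarrow> real^2" where
  "ivec i j = vector [of_int i, of_int j]"

text \<open>Offset, labels and index set are kept apart: a translation changes only
  \<open>b\<close>, and a substitution step acts on each of the three by a simple formula.\<close>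

definition cluster :: "real^2 \<Rightarrow> (int \<Rightarrow> int \<Rightarrow> arrow) \<Rightarrow> (int \<times> int) set \<Rightarrow> tile set" where
  "cluster b g X = (\<lambda>(i, j). (b + ivec i j, g i j)) ` X"

abbreviation block :: "int \<Rightarrow> int \<Rightarrow> (int \<times> int) set" where
  "block m n \<equiv> {m..<n} \<times> {m..<n}"

abbreviation half :: "real^2" where "half \<equiv> vector [1/2, 1/2]"

lemma ivec_nth [simp]: "ivec i j $ 1 = of_int i" "ivec i j $ 2 = of_int j"
  by (simp_all add: ivec_def)

lemma ivec_inject [simp]: "ivec i j = ivec i' j' \<longleftrightarrow> i = i' \<and> j = j'"
  by (auto simp: vec_eq_iff forall_2)

lemma opp_opp [simp]: "opp (opp a) = a" by (cases a) auto
lemma opp_neq [simp]: "opp a \<noteq> a" "a \<noteq> opp a" by (cases a; simp)+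
lemma opp_inject [simp]: "opp a = opp b \<longleftrightarrow> a = b" by (metis opp_opp)

lemma child_opp: "child (opp a) (opp q) = opp (child a q)"
  by (auto simp: child_def)

text \<open>The corner \<open>q = a\<close> separates \<open>a\<close> from every other arrow, whose
  child there is \<open>opp a\<close>. This is what recovers a parent from its children.\<close>

lemma child_inject: "(\<And>q. child a q = child b q) \<Longrightarrow> a = b"
  by (metis child_def opp_neq(1))

section \<open>Substituted clusters\<close>

lemma subst_tile_eq: "subst_tile (c, a) =
    (\<lambda>(e, f). (2 *\<^sub>R c - half + ivec e f, child a (corner e f))) ` ({0, 1} \<times> {0, 1})"
proof -
  have *: "2 *\<^sub>R c - half + ivec 0 0 = 2 *\<^sub>R c + vector [-1/2, -1/2]"
    "2 *\<^sub>R c - half + ivec 1 0 = 2 *\<^sub>R c + vector [1/2, -1/2]"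
    "2 *\<^sub>R c - half + ivec 0 1 = 2 *\<^sub>R c + vector [-1/2, 1/2]"
    "2 *\<^sub>R c - half + ivec 1 1 = 2 *\<^sub>R c + vector [1/2, 1/2]"
    by (simp_all add: vec_eq_iff forall_2)
  have **: "{0, 1} \<times> {0, 1} = {(0, 0), (1, 0), (0, 1), (1 :: int, 1 :: int)}" by auto
  show ?thesis
    unfolding ** by (cases a) (auto simp: * subst_tile_NE subst_tile_NW subst_tile_SW subst_tile_SE
      child_def corner_def)
qed

text \<open>The children of square (i, j) are the squares (2i + e, 2j + f) with e, f in {0, 1}; the
  new offset is the centre of the lower left child of a tile centred at \<open>b\<close>.\<close>

lemma subst_cluster: "subst (cluster b g X) =
    cluster (2 *\<^sub>R b - half) (inflate g) {(i, j). (i div 2, j div 2) \<in> X}" (is "?L = ?R")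
proof
  show "?L \<subseteq> ?R"
  proof
    fix s assume "s \<in> ?L"
    then obtain i j where ij: "(i, j) \<in> X" and "s \<in> subst_tile (b + ivec i j, g i j)"
      by (auto simp: subst_def cluster_def)
    then obtain e f where ef: "e \<in> {0, 1}" "f \<in> {0, 1}"
      and s: "s = (2 *\<^sub>R (b + ivec i j) - half + ivec e f, child (g i j) (corner e f))"
      by (auto simp: subst_tile_eq)
    have "2 *\<^sub>R (b + ivec i j) - half + ivec e f = 2 *\<^sub>R b - half + ivec (2 * i + e) (2 * j + f)"
      by (simp add: vec_eq_iff forall_2)
    moreover have d: "(2 * i + e) div 2 = i" "(2 * j + f) div 2 = j"
      "corner (2 * i + e) (2 * j + f) = corner e f"
      using ef by (auto simp: corner_def)
    ultimately have "s = (2 *\<^sub>R b - half + ivec (2 * i + e) (2 * j + f),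
        inflate g (2 * i + e) (2 * j + f))"
      unfolding s inflate_def d by simp
    then show "s \<in> ?R" unfolding cluster_def using d ij by (intro image_eqI[where x="(2 * i + e, 2 * j + f)"]) auto
  qed
  show "?R \<subseteq> ?L"
  proof
    fix s assume "s \<in> ?R"
    then obtain i j where ij: "(i div 2, j div 2) \<in> X"
      and s: "s = (2 *\<^sub>R b - half + ivec i j, inflate g i j)"
      by (auto simp: cluster_def)
    have "real_of_int k = 2 * of_int (k div 2) + of_int (k mod 2)" for k
      by (metis mult_div_mod_eq of_int_add of_int_mult of_int_numeral)
    note this[of i] this[of j]
    then have "2 *\<^sub>R b - half + ivec i j =
        2 *\<^sub>R (b + ivec (i div 2) (j div 2)) - half + ivec (i mod 2) (j mod 2)"
      by (simp add: vec_eq_iff forall_2)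
    moreover have "corner i j = corner (i mod 2) (j mod 2)" by (simp add: corner_def)
    ultimately have "s = (2 *\<^sub>R (b + ivec (i div 2) (j div 2)) - half + ivec (i mod 2) (j mod 2),
        child (g (i div 2) (j div 2)) (corner (i mod 2) (j mod 2)))"
      unfolding s inflate_def by simp
    moreover have "i mod 2 \<in> {0, 1}" "j mod 2 \<in> {0, 1}" by auto
    ultimately have "s \<in> subst_tile (b + ivec (i div 2) (j div 2), g (i div 2) (j div 2))"
      unfolding subst_tile_eq by (intro image_eqI[where x="(i mod 2, j mod 2)"]) auto
    then show "s \<in> ?L" unfolding subst_def cluster_def using ij by (auto intro!: bexI)
  qed
qed

lemma subst_cluster_block: "subst (cluster b g (block m n)) =
    cluster (2 *\<^sub>R b - half) (inflate g) (block (2 * m) (2 * n))"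
proof -
  have "{(i, j). (i div 2, j div 2) \<in> block m n} = block (2 * m) (2 * n)" by auto
  then show ?thesis by (simp add: subst_cluster)
qed

lemma subst_pow_tile:
  "\<exists>b. (subst ^^ n) {(c, a)} = cluster b ((inflate ^^ n) (\<lambda>_ _. a)) (block 0 (2 ^ n))"
proof (induction n)
  case 0
  have "block 0 1 = {(0, 0)}" by auto
  moreover have "c + ivec 0 0 = c" by (simp add: vec_eq_iff forall_2)
  ultimately have "{(c, a)} = cluster c (\<lambda>_ _. a) (block 0 1)"
    by (simp add: cluster_def)
  then show ?case by auto
next
  case (Suc n)
  then show ?case by (auto simp: subst_cluster_block)
qed

lemma outward_star_eq: "outward_star = cluster half quadrant (block (-1) 1)"
proof -
  have *: "block (-1) 1 = {(0, 0), (-1, 0), (-1, -1), (0, -1)}" by auto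
  have **: "half + ivec 0 0 = vector [1/2, 1/2]" "half + ivec (-1) 0 = vector [-1/2, 1/2]"
    "half + ivec (-1) (-1) = vector [-1/2, -1/2]" "half + ivec 0 (-1) = vector [1/2, -1/2]"
    by (simp_all add: vec_eq_iff forall_2)
  show ?thesis unfolding * cluster_def outward_star_def by (simp add: ** quadrant_def)
qed

text \<open>\<open>half\<close> is a fixed point of the change of offset, so all iterates of the
  star share one lattice while their blocks double around the origin.\<close>

lemma subst_pow_star:
  "(subst ^^ n) outward_star = cluster half ((inflate ^^ n) quadrant) (block (- (2 ^ n)) (2 ^ n))"
proof (induction n)
  case (Suc n)
  have "2 *\<^sub>R half - half = half" by (simp add: vec_eq_iff forall_2)
  then show ?case using Suc by (simp add: subst_cluster_block)
qed (simp add: outward_star_eq)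

section \<open>Tilings by unit squares\<close>

lemma center_in_interior: "c \<in> interior (support (c, a))"
  by (simp add: support_def interior_cbox mem_box_cart forall_2)

lemma closure_interior_support: "closure (interior (support t)) = support t"
proof -
  have "fst t \<in> box (fst t - half) (fst t + half)"
    by (simp add: mem_box_cart forall_2)
  then have "box (fst t - half) (fst t + half) \<noteq> {}" by blast
  then show ?thesis by (simp add: support_def interior_cbox)
qed

text \<open>The centre of any tile of \<open>T\<close> lies in a tile of \<open>S\<close>, so the
  interiors of these two tiles meet and they coincide. This turns inclusions of tilings into
  equalities.\<close>

lemma covering_subset_of_tiling_eq:
  assumes "(\<Union>s\<in>S. support s) = UNIV" "S \<subseteq> T" "is_tiling T"
  shows "S = T"
proof -
  have "t \<in> S" if t: "t \<in> T" for t
  proof -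
    obtain s where s: "s \<in> S" "fst t \<in> support s" using assms(1) by blast
    have "fst t \<in> interior (support t)" by (metis center_in_interior prod.collapse)
    then have "interior (support t) \<inter> closure (interior (support s)) \<noteq> {}"
      using s closure_interior_support by auto
    then have "interior (support t) \<inter> interior (support s) \<noteq> {}"
      by (simp add: open_Int_closure_eq_empty)
    then have "s = t" using assms(2,3) s(1) t unfolding is_tiling_def by blast
    then show ?thesis using s(1) by simp
  qed
  then show ?thesis using assms(2) by blast
qed

text \<open>A parallel slab of the same width at integer distance \<open>d\<close> contains
  \<open>S\<close> if d = 0, meets it in a supporting hyperplane if d is 1 or -1, and misses it
  otherwise.\<close>

lemma unit_slab_face_of:
  fixes S :: "(real^2) set"
  assumes "convex S" "\<And>x. x \<in> S \<Longrightarrow> u \<le> x $ k \<and> x $ k \<le> u + 1"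
  shows "(S \<inter> {x. u + of_int d \<le> x $ k \<and> x $ k \<le> u + of_int d + 1}) face_of S"
proof -
  have inner: "axis k 1 \<bullet> x = x $ k" for x :: "real^2" by (simp add: inner_axis')
  consider "d = 0" | "d = 1" | "d = -1" | "d \<le> -2 \<or> 2 \<le> d" by linarith
  then show ?thesis
  proof cases
    case 1
    then have "S \<inter> {x. u + of_int d \<le> x $ k \<and> x $ k \<le> u + of_int d + 1} = S"
      using assms(2) by auto
    then show ?thesis using assms(1) by (simp add: face_of_refl)
  next
    case 2
    have "u + of_int d \<le> x $ k \<and> x $ k \<le> u + of_int d + 1 \<longleftrightarrow> x $ k = u + 1" if "x \<in> S" for x
      using assms(2)[OF that] 2 by auto
    then have "S \<inter> {x. u + of_int d \<le> x $ k \<and> x $ k \<le> u + of_int d + 1} =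
        S \<inter> {x. axis k 1 \<bullet> x = u + 1}"
      unfolding inner by blast
    moreover have "(S \<inter> {x. axis k 1 \<bullet> x = u + 1}) face_of S"
      by (rule face_of_Int_supporting_hyperplane_le) (use assms in \<open>auto simp: inner\<close>)
    ultimately show ?thesis by simp
  next
    case 3
    have "u + of_int d \<le> x $ k \<and> x $ k \<le> u + of_int d + 1 \<longleftrightarrow> x $ k = u" if "x \<in> S" for x
      using assms(2)[OF that] 3 by auto
    then have "S \<inter> {x. u + of_int d \<le> x $ k \<and> x $ k \<le> u + of_int d + 1} =
        S \<inter> {x. axis k 1 \<bullet> x = u}"
      unfolding inner by blast
    moreover have "(S \<inter> {x. axis k 1 \<bullet> x = u}) face_of S"
      by (rule face_of_Int_supporting_hyperplane_ge) (use assms in \<open>auto simp: inner\<close>)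
    ultimately show ?thesis by simp
  next
    case 4
    have "u + of_int d \<le> x $ k \<and> x $ k \<le> u + of_int d + 1 \<Longrightarrow> x \<notin> S" for x
    proof
      assume x: "u + of_int d \<le> x $ k \<and> x $ k \<le> u + of_int d + 1" "x \<in> S"
      have "real_of_int d \<le> - 2 \<or> 2 \<le> real_of_int d" using 4 by linarith
      then show False using x assms(2)[of x] by linarith
    qed
    then have "S \<inter> {x. u + of_int d \<le> x $ k \<and> x $ k \<le> u + of_int d + 1} = {}" by blast
    then show ?thesis by simp
  qed
qed

text \<open>The second square cuts the first by one slab per coordinate, and an intersection of two
  faces is a face.\<close>

lemma support_Int_face_of:
  "(support (b + ivec i j, a) \<inter> support (b + ivec i' j', a')) face_of support (b + ivec i j, a)"
proof -
  let ?S = "support (b + ivec i j, a)"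
  have S: "convex ?S" by (simp add: support_def convex_box)
  let ?u = "b $ 1 + of_int i - 1/2" and ?v = "b $ 2 + of_int j - 1/2"
  have f1: "(?S \<inter> {x. ?u + of_int (i' - i) \<le> x $ 1 \<and> x $ 1 \<le> ?u + of_int (i' - i) + 1}) face_of ?S"
    by (rule unit_slab_face_of[OF S]) (simp add: support_iff)
  have f2: "(?S \<inter> {x. ?v + of_int (j' - j) \<le> x $ 2 \<and> x $ 2 \<le> ?v + of_int (j' - j) + 1}) face_of ?S"
    by (rule unit_slab_face_of[OF S]) (simp add: support_iff)
  have "?S \<inter> support (b + ivec i' j', a') =
    (?S \<inter> {x. ?u + of_int (i' - i) \<le> x $ 1 \<and> x $ 1 \<le> ?u + of_int (i' - i) + 1}) \<inter>
    (?S \<inter> {x. ?v + of_int (j' - j) \<le> x $ 2 \<and> x $ 2 \<le> ?v + of_int (j' - j) + 1})"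
    by (auto simp: support_iff)
  then show ?thesis using face_of_Int[OF f1 f2] by simp
qed

lemma interior_support_disjoint:
  assumes "(i, j) \<noteq> (i', j')"
  shows "interior (support (b + ivec i j, a)) \<inter> interior (support (b + ivec i' j', a')) = {}"
proof -
  have "i \<noteq> i' \<or> j \<noteq> j'" using assms by auto
  then consider "i + 1 \<le> i'" | "i' + 1 \<le> i" | "j + 1 \<le> j'" | "j' + 1 \<le> j" by linarith
  then have "real_of_int i + 1 \<le> of_int i' \<or> real_of_int i' + 1 \<le> of_int i \<or>
      real_of_int j + 1 \<le> of_int j' \<or> real_of_int j' + 1 \<le> of_int j"
    by cases linarith+
  then show ?thesis
    by (force simp: support_def interior_cbox mem_box_cart forall_2)
qed

lemma cluster_memI: "(i, j) \<in> X \<Longrightarrow> (b + ivec i j, g i j) \<in> cluster b g X"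
  by (auto simp: cluster_def intro!: image_eqI[where x="(i, j)"])

lemma cluster_memE:
  assumes "t \<in> cluster b g X"
  obtains i j where "(i, j) \<in> X" "t = (b + ivec i j, g i j)"
  using assms by (auto simp: cluster_def)

lemma cluster_functional:
  "(c, a) \<in> cluster b g X \<Longrightarrow> (c, a') \<in> cluster b g X \<Longrightarrow> a = a'"
  by (auto simp: cluster_def)

section \<open>The fixed point with outward star\<close>

definition star_tiling :: "tile set" where
  "star_tiling = (\<Union>n. (subst ^^ n) outward_star)"

lemma subst_mono: "P \<subseteq> Q \<Longrightarrow> subst P \<subseteq> subst Q"
  by (auto simp: subst_def)

lemma subst_pow_mono: "P \<subseteq> Q \<Longrightarrow> (subst ^^ n) P \<subseteq> (subst ^^ n) Q"
  by (induction n) (auto intro: subst_mono[THEN subsetD])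

lemma subst_UN: "subst (\<Union>n\<in>I. P n) = (\<Union>n\<in>I. subst (P n))"
  by (auto simp: subst_def)

text \<open>The child touching the origin sits in the corner opposite to its outward parent, hence
  points to the centre of the parent's \<open>2 x 2\<close> square, away from the origin.\<close>

lemma outward_star_subset_subst: "outward_star \<subseteq> subst outward_star"
proof -
  have "inflate quadrant i j = quadrant i j" if "(i, j) \<in> block (-1) 1" for i j
  proof -
    have "i = 0 \<or> i = -1" "j = 0 \<or> j = -1" using that by auto
    then show ?thesis by (auto simp: inflate_def corner_def child_def quadrant_def)
  qed
  moreover have "subst outward_star = cluster half (inflate quadrant) (block (-2) 2)"
    using subst_pow_star[of 1] by simp
  ultimately have "(half + ivec i j, quadrant i j) \<in> subst outward_star"
    if "(i, j) \<in> block (-1) 1" for i j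
    using cluster_memI[of i j "block (-2) 2" half "inflate quadrant"] that by auto
  then show ?thesis by (auto simp: outward_star_eq elim!: cluster_memE)
qed

lemma subst_pow_star_mono: "m \<le> n \<Longrightarrow> (subst ^^ m) outward_star \<subseteq> (subst ^^ n) outward_star"
proof (rule lift_Suc_mono_le)
  show "(subst ^^ n) outward_star \<subseteq> (subst ^^ Suc n) outward_star" for n
    using subst_pow_mono[OF outward_star_subset_subst, of n] by (simp add: funpow_swap1)
qed

lemma subst_star_tiling: "subst star_tiling = star_tiling"
proof -
  have "subst star_tiling = (\<Union>n. (subst ^^ Suc n) outward_star)"
    by (simp add: star_tiling_def subst_UN)
  also have "\<dots> = star_tiling"
    unfolding star_tiling_def using subst_pow_star_mono[OF le_SucI[OF order_refl]]
    by (intro equalityI UN_least) (blast, blast)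
  finally show ?thesis .
qed

lemma star_tiling_pair:
  assumes "s \<in> star_tiling" "t \<in> star_tiling"
  obtains n where "s \<in> (subst ^^ n) outward_star" "t \<in> (subst ^^ n) outward_star"
proof -
  obtain m n where "s \<in> (subst ^^ m) outward_star" "t \<in> (subst ^^ n) outward_star"
    using assms by (auto simp: star_tiling_def)
  then show ?thesis
    using that[of "max m n"] subst_pow_star_mono[of m "max m n"] subst_pow_star_mono[of n "max m n"]
    by auto
qed

lemma star_tiling_covers: "(\<Union>t\<in>star_tiling. support t) = UNIV"
proof -
  have "x \<in> (\<Union>t\<in>star_tiling. support t)" for x
  proof -
    let ?i = "\<lfloor>x $ 1\<rfloor>" and ?j = "\<lfloor>x $ 2\<rfloor>"
    \<comment> \<open>As n < 2 ^ n, the n-th iterate reaches the square containing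
      \<open>x\<close>.\<close>
    define n where "n = nat (\<bar>?i\<bar> + \<bar>?j\<bar>)"
    have "\<bar>?i\<bar> + \<bar>?j\<bar> < 2 ^ n"
      using of_nat_less_two_power[of n, where 'a = int] by (simp add: n_def)
    then have "(?i, ?j) \<in> block (- (2 ^ n)) (2 ^ n)" by auto
    then have "(half + ivec ?i ?j, (inflate ^^ n) quadrant ?i ?j) \<in> star_tiling"
      unfolding star_tiling_def subst_pow_star by (intro UN_I[of n] cluster_memI) auto
    moreover have "x \<in> support (half + ivec ?i ?j, (inflate ^^ n) quadrant ?i ?j)"
      by (simp add: support_iff) linarith
    ultimately show ?thesis by blast
  qed
  then show ?thesis by blast
qed

lemma is_tiling_star_tiling: "is_tiling star_tiling"
  unfolding is_tiling_def
proof (intro conjI ballI impI star_tiling_covers)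
  fix s t assume st: "s \<in> star_tiling" "t \<in> star_tiling" and ne: "s \<noteq> t"
  from st obtain n where "s \<in> (subst ^^ n) outward_star" "t \<in> (subst ^^ n) outward_star"
    by (rule star_tiling_pair)
  then obtain i j i' j' where
    s: "s = (half + ivec i j, (inflate ^^ n) quadrant i j)" and
    t: "t = (half + ivec i' j', (inflate ^^ n) quadrant i' j')"
    by (auto simp: subst_pow_star cluster_def)
  show "interior (support s) \<inter> interior (support t) = {}"
    using ne unfolding s t by (intro interior_support_disjoint) auto
  show "(support s \<inter> support t) face_of support s"
    unfolding s t by (rule support_Int_face_of)
  show "(support s \<inter> support t) face_of support t"
    unfolding s t by (subst Int_commute) (rule support_Int_face_of)
qed

lemma touching_origin_star_tiling: "touching_origin star_tiling = outward_star"
proof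
  have "outward_star \<subseteq> star_tiling"
    unfolding star_tiling_def by (intro subsetI UN_I[of 0]) simp_all
  moreover have "0 \<in> support t" if "t \<in> outward_star" for t
    using that by (auto simp: outward_star_def support_iff)
  ultimately show "outward_star \<subseteq> touching_origin star_tiling"
    by (auto simp: touching_origin_def)
  show "touching_origin star_tiling \<subseteq> outward_star"
  proof
    fix t assume "t \<in> touching_origin star_tiling"
    then obtain n where t: "t \<in> (subst ^^ n) outward_star" and 0: "0 \<in> support t"
      by (auto simp: touching_origin_def star_tiling_def)
    then obtain i j a where t_eq: "t = (half + ivec i j, a)"
      by (auto simp: subst_pow_star cluster_def)
    have "i \<le> 0" "-1 \<le> i" "j \<le> 0" "-1 \<le> j" using 0 by (auto simp: t_eq support_iff)
    then have "(half + ivec i j, quadrant i j) \<in> outward_star"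
      unfolding outward_star_eq by (intro cluster_memI) auto
    moreover from this have "(half + ivec i j, quadrant i j) \<in> (subst ^^ n) outward_star"
      using subst_pow_star_mono[of 0 n] by auto
    then have "quadrant i j = a"
      using t unfolding t_eq subst_pow_star by (rule cluster_functional)
    ultimately show "t \<in> outward_star" by (simp add: t_eq)
  qed
qed

section \<open>Translations\<close>

lemma translate_translate: "translate v (translate w P) = translate (v + w) P"
  by (force simp: translate_def)

lemma translate_0: "translate 0 P = P"
  by (force simp: translate_def)

lemma translate_mono: "P \<subseteq> Q \<Longrightarrow> translate v P \<subseteq> translate v Q"
  by (auto simp: translate_def)

lemma translate_cluster: "translate v (cluster b g X) = cluster (v + b) g X"
  by (force simp: translate_def cluster_def add.assoc)

lemma subst_translate: "subst (translate v P) = translate (2 *\<^sub>R v) (subst P)"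
proof -
  have "subst_tile (v + c, a) = translate (2 *\<^sub>R v) (subst_tile (c, a))" for c a
    unfolding subst_tile_eq translate_def by (simp add: image_image case_prod_unfold algebra_simps)
  then show ?thesis
    by (auto simp: subst_def translate_def) force+
qed

lemma subst_pow_translate: "(subst ^^ n) (translate v P) = translate (2 ^ n *\<^sub>R v) ((subst ^^ n) P)"
  by (induction n) (simp_all add: subst_translate)

lemma outward_star_occurs: "\<exists>w. translate w outward_star \<subseteq> (subst ^^ 3) {(0, NE)}"
proof -
  let ?F = "(inflate ^^ 3) (\<lambda>_ _. NE)"
  obtain b where b: "(subst ^^ 3) {(0, NE)} = cluster b ?F (block 0 8)"
    using subst_pow_tile[of 3 0 NE] by auto
  \<comment> \<open>The vertex (2, 4) doubles the vertex (1, 2) of the level 2 supertile, where no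
    arrow points inward because its coordinates have different parity; so all four children at (2,
    4) point outward.\<close>
  have "(b + ivec 2 4 - half + half + ivec i j, quadrant i j) \<in> cluster b ?F (block 0 8)"
    if "(i, j) \<in> block (-1) 1" for i j
  proof -
    have ij: "i = 0 \<or> i = -1" "j = 0 \<or> j = -1" using that by auto
    then have "?F (2 + i) (4 + j) = quadrant i j"
      by (auto simp: numeral_3_eq_3 inflate_def corner_def child_def quadrant_def)
    moreover have "b + ivec 2 4 - half + half + ivec i j = b + ivec (2 + i) (4 + j)"
      by (simp add: vec_eq_iff forall_2)
    ultimately show ?thesis
      unfolding cluster_def using ij by (intro image_eqI[where x="(2 + i, 4 + j)"]) auto
  qed
  then have "translate (b + ivec 2 4 - half) outward_star \<subseteq> cluster b ?F (block 0 8)"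
    unfolding outward_star_eq translate_cluster by (auto simp: cluster_def)
  then show ?thesis using b by auto
qed

text \<open>A finite patch lies in a single iterate of the star. Since a translate of the star
  occurs in a level 3 supertile, a translate of the n-th iterate occurs in one of level n +
  3.\<close>

lemma star_tiling_Omega: "star_tiling \<in> Omega"
  unfolding Omega_def
proof (intro CollectI conjI is_tiling_star_tiling allI impI)
  fix P assume P: "finite P \<and> P \<subseteq> star_tiling"
  then have "finite P" "P \<subseteq> star_tiling" by auto
  then have "\<exists>n. P \<subseteq> (subst ^^ n) outward_star"
  proof (induction P)
    case (insert s P)
    then obtain m n where "P \<subseteq> (subst ^^ m) outward_star" "s \<in> (subst ^^ n) outward_star"
      by (auto simp: star_tiling_def)
    then have "insert s P \<subseteq> (subst ^^ max m n) outward_star"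
      using subst_pow_star_mono[of m "max m n"] subst_pow_star_mono[of n "max m n"] by auto
    then show ?case by blast
  qed simp
  then obtain n where n: "P \<subseteq> (subst ^^ n) outward_star" by blast
  obtain w where w: "translate w outward_star \<subseteq> (subst ^^ 3) {(0, NE)}"
    using outward_star_occurs by blast
  have "translate (2 ^ n *\<^sub>R w) P \<subseteq> translate (2 ^ n *\<^sub>R w) ((subst ^^ n) outward_star)"
    using n by (rule translate_mono)
  also have "\<dots> \<subseteq> (subst ^^ n) ((subst ^^ 3) {(0, NE)})"
    unfolding subst_pow_translate[symmetric] using w by (rule subst_pow_mono)
  finally have "translate (2 ^ n *\<^sub>R w) P \<subseteq> (subst ^^ (n + 3)) {(0, NE)}"
    by (simp add: funpow_add)
  moreover have "P = translate (- (2 ^ n *\<^sub>R w)) (translate (2 ^ n *\<^sub>R w) P)"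
    by (simp add: translate_translate translate_0)
  ultimately show "\<exists>t n v Q. Q \<subseteq> (subst ^^ n) {t} \<and> P = translate v Q" by blast
qed

section \<open>Invariance under the dihedral group\<close>

lemma dir_act_arrow: "A \<in> carrier O2Z \<Longrightarrow> dir (act_arrow A a) = A *v dir a"
  unfolding carrier_O2Z
  by (elim insertE emptyE; cases a; simp only: act_arrow_simps; simp add: O2Z_mats mat2_vector)

lemma act_arrow_mult:
  assumes "A \<in> carrier O2Z" "B \<in> carrier O2Z"
  shows "act_arrow (A ** B) a = act_arrow A (act_arrow B a)"
  by (rule act_arrow_eqI) (simp add: dir_act_arrow assms matrix_vector_mul_assoc)

lemma O2Z_mult_closed: "A \<in> carrier O2Z \<Longrightarrow> B \<in> carrier O2Z \<Longrightarrow> A ** B \<in> carrier O2Z"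
  using group.subgroup_self[OF O2Z_group, THEN subgroup.m_closed, of A B] by (simp add: O2Z_def)

text \<open>If \<open>B\<close> carries NE to the arrow of \<open>t\<close>, then
  \<open>A ** B\<close> carries NE to the arrow of the image tile, so the picture drawn with
  \<open>B\<close> is moved to the one drawn with \<open>A ** B\<close>.\<close>

lemma act_subst_tile:
  assumes A: "A \<in> carrier O2Z"
  shows "act A (subst_tile t) \<subseteq> subst_tile (act_tile A t)"
proof
  fix s assume "s \<in> act A (subst_tile t)"
  then obtain B q where B: "B \<in> carrier O2Z" "act_arrow B NE = snd t"
    and s: "s = act_tile A (2 *\<^sub>R fst t + (1/2) *\<^sub>R dir (act_arrow B q), act_arrow B (ne_child q))"
    by (auto simp: act_def subst_tile_def)
  have "s = (2 *\<^sub>R fst (act_tile A t) + (1/2) *\<^sub>R dir (act_arrow (A ** B) q),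
      act_arrow (A ** B) (ne_child q))"
    unfolding s by (simp add: act_tile_def act_arrow_mult A B dir_act_arrow
        matrix_vector_right_distrib matrix_vector_mult_scaleR)
  moreover have "act_arrow (A ** B) NE = snd (act_tile A t)"
    using A B by (simp add: act_arrow_mult act_tile_def)
  ultimately show "s \<in> subst_tile (act_tile A t)"
    unfolding subst_tile_def using O2Z_mult_closed[OF A B(1)] by blast
qed

lemma act_subst: "A \<in> carrier O2Z \<Longrightarrow> act A (subst P) \<subseteq> subst (act A P)"
  using act_subst_tile[of A] by (simp add: subst_def act_def image_UN UN_mono)

lemma act_outward_star: "A \<in> carrier O2Z \<Longrightarrow> act A outward_star \<subseteq> outward_star"
  unfolding carrier_O2Z
  by (elim insertE emptyE)
    (simp_all add: act_def act_tile_def outward_star_def act_arrow_simps,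
      simp_all add: O2Z_mats mat2_vector)

lemma act_star_tiling:
  assumes A: "A \<in> carrier O2Z"
  shows "act A star_tiling = star_tiling"
\<comment> \<open>An inclusion and surjectivity of \<open>A\<close> suffice: the image is a part of
  the tiling that still covers the plane.\<close>
proof (rule covering_subset_of_tiling_eq[OF _ _ is_tiling_star_tiling])
  have "act A ((subst ^^ n) outward_star) \<subseteq> (subst ^^ n) outward_star" for n
  proof (induction n)
    case (Suc n)
    show ?case
      using order_trans[OF act_subst[OF A] subst_mono[OF Suc]] by simp
  qed (simp add: act_outward_star A)
  then show "act A star_tiling \<subseteq> star_tiling"
    unfolding star_tiling_def by (auto simp: act_def)
  have "A ** transpose A = mat 1" using A by (simp add: O2Z_def orthogonal_matrix_def)
  then have "y = A *v (transpose A *v y)" for y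
    by (simp add: matrix_vector_mul_assoc del: transpose_matrix_vector)
  then have "surj (\<lambda>x. A *v x)" by (rule surjI[OF sym])
  moreover have "(\<Union>t\<in>act A star_tiling. support t) = (\<lambda>x. A *v x) ` (\<Union>t\<in>star_tiling. support t)"
    by (auto simp: act_def support_act_tile[OF A])
  ultimately show "(\<Union>t\<in>act A star_tiling. support t) = UNIV"
    by (simp add: star_tiling_covers)
qed

section \<open>Centrally symmetric windows\<close>

lemma child_corners:
  "child a NE = SW \<longleftrightarrow> a \<noteq> NE" "child a SW = NE \<longleftrightarrow> a \<noteq> SW"
  "child a NW = SE \<longleftrightarrow> a \<noteq> NW" "child a SE = NW \<longleftrightarrow> a \<noteq> SE"
  "child a NE = NE \<longleftrightarrow> a = NE" "child a SW = SW \<longleftrightarrow> a = SW"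
  "child a NW = NW \<longleftrightarrow> a = NW" "child a SE = SE \<longleftrightarrow> a = SE"
  "child a NE \<noteq> SE" "child a NE \<noteq> NW" "child a SW \<noteq> SE" "child a SW \<noteq> NW"
  "child a SE \<noteq> SW" "child a SE \<noteq> NE" "child a NW \<noteq> SW" "child a NW \<noteq> NE"
  by (cases a; simp add: child_def)+

lemma corner_double:
  "corner (2 * i) (2 * j) = SW" "corner (2 * i - 1) (2 * j) = SE"
  "corner (2 * i) (2 * j - 1) = NW" "corner (2 * i - 1) (2 * j - 1) = NE"
  by (auto simp: corner_def)

text \<open>The four squares around an even vertex have four different parents, those around the
  halved vertex, and each is the corner of its parent facing the vertex.\<close>

lemma inflate_double:
  "inflate g (2 * i) (2 * j) = child (g i j) SW"
  "inflate g (2 * i - 1) (2 * j) = child (g (i - 1) j) SE"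
  "inflate g (2 * i) (2 * j - 1) = child (g i (j - 1)) NW"
  "inflate g (2 * i - 1) (2 * j - 1) = child (g (i - 1) (j - 1)) NE"
proof -
  have *: "(2 * n - 1) div 2 = n - 1" for n :: int by presburger
  show "inflate g (2 * i) (2 * j) = child (g i j) SW"
    "inflate g (2 * i - 1) (2 * j) = child (g (i - 1) j) SE"
    "inflate g (2 * i) (2 * j - 1) = child (g i (j - 1)) NW"
    "inflate g (2 * i - 1) (2 * j - 1) = child (g (i - 1) (j - 1)) NE"
    by (simp_all add: inflate_def corner_double *)
qed

text \<open>At a vertex with even coordinates an arrow points inward iff that of its parent does, at a
  vertex with two odd coordinates exactly three arrows point inward, and at any other vertex
  none does.\<close>

lemma symmetric_vertex_not_inward:
  assumes "0 < v" "v < 2 ^ n" "0 < w" "w < 2 ^ n"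
    and "h = (inflate ^^ n) (\<lambda>_ _. a)"
    and "h v w = SW \<longleftrightarrow> h (v - 1) (w - 1) = NE" "h (v - 1) w = SE \<longleftrightarrow> h v (w - 1) = NW"
  shows "h v w \<noteq> SW \<and> h (v - 1) w \<noteq> SE"
  using assms
proof (induction n arbitrary: v w h)
  case 0
  then show ?case by simp
next
  case (Suc n)
  define g where "g = (inflate ^^ n) (\<lambda>_ _. a)"
  have h: "h = inflate g" by (simp add: Suc.prems g_def)
  consider (even) v' w' where "v = 2 * v'" "w = 2 * w'" | (odd) "odd v" "odd w"
    | (mixed) "odd (v + w)"
    by (metis dvd_def odd_add)
  then show ?case
  proof cases
    case even
    show ?thesis
      using Suc.prems(1-4,6-) Suc.IH[of v' w' g] unfolding even h inflate_double
      by (simp add: child_corners g_def)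
  next
    case odd
    \<comment> \<open>All four squares are children of one tile, so exactly one of them does not
      point inward; its opposite does, against the hypotheses.\<close>
    then obtain v' w' where vw: "v = 2 * v' + 1" "w = 2 * w' + 1" by (meson oddE)
    have "corner (2 * v' + 1) (2 * w' + 1) = NE" "corner (2 * v') (2 * w' + 1) = NW"
      "corner (2 * v' + 1) (2 * w') = SE" "corner (2 * v') (2 * w') = SW"
      by (simp_all add: corner_def)
    then show ?thesis using Suc.prems(6-) unfolding h vw
      by (cases "g v' w'") (simp_all add: inflate_def child_def)
  next
    case mixed
    then show ?thesis unfolding h by (auto simp: inflate_def corner_def child_corners)
  qed
qed

text \<open>The reflection \<open>(i, j) \<mapsto> (k - i, l - j)\<close> of indices is the rotation by 180 degrees about the
  point \<open>((k + 1) / 2, (l + 1) / 2)\<close>, tile \<open>(i, j)\<close> being the square with lower left corner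
  \<open>(i, j)\<close>.\<close>

definition symmetric_within :: "int \<Rightarrow> (int \<Rightarrow> int \<Rightarrow> arrow) \<Rightarrow> int \<Rightarrow> int \<Rightarrow> bool" where
  "symmetric_within r h k l \<longleftrightarrow>
     (\<forall>i j. \<bar>2 * i - k\<bar> \<le> r \<and> \<bar>2 * j - l\<bar> \<le> r \<longrightarrow> h (k - i) (l - j) = opp (h i j))"

lemma inflate_axis: "inflate g i j \<in> {NE, SW} \<longleftrightarrow> even (i + j)"
  by (auto simp: inflate_def corner_def child_corners child_def)

lemma opp_axis: "opp a \<in> {NE, SW} \<longleftrightarrow> a \<in> {NE, SW}"
  by (cases a) auto

text \<open>The centre of symmetry is a vertex iff \<open>k\<close> and \<open>l\<close> are both
  odd. An edge midpoint is excluded by the axes, a tile centre because its arrow would be its own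
  opposite.\<close>

lemma symmetric_within_odd:
  assumes "symmetric_within r (inflate g) k l" "1 \<le> r"
  shows "odd k \<and> odd l"
proof -
  let ?i = "k div 2" and ?j = "l div 2"
  have "\<bar>2 * ?i - k\<bar> \<le> 1" "\<bar>2 * ?j - l\<bar> \<le> 1" by linarith+
  then have eq: "inflate g (k - ?i) (l - ?j) = opp (inflate g ?i ?j)"
    using assms unfolding symmetric_within_def by force
  then have "even (k - ?i + (l - ?j)) \<longleftrightarrow> even (?i + ?j)"
    using inflate_axis[of g] opp_axis by metis
  then have "even (k + l)" by (auto simp: algebra_simps)
  moreover have "\<not> (even k \<and> even l)"
  proof
    assume "even k \<and> even l"
    then have "k - ?i = ?i" "l - ?j = ?j" by auto
    then show False using eq opp_neq by metis
  qed
  ultimately show ?thesis by auto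
qed

text \<open>The reflection maps the child of (i, j) in one corner to the child of (k - i, l - j) in
  the opposite corner. Passing to children doubles the distance to the centre up to 1, whence the
  radius 2r + 1.\<close>

lemma symmetric_within_parent:
  assumes "symmetric_within (2 * r + 1) (inflate g) (2 * k + 1) (2 * l + 1)"
  shows "symmetric_within r g k l"
  unfolding symmetric_within_def
proof (intro allI impI)
  fix i j assume ij: "\<bar>2 * i - k\<bar> \<le> r \<and> \<bar>2 * j - l\<bar> \<le> r"
  show "g (k - i) (l - j) = opp (g i j)"
  proof (rule child_inject)
    fix q
    have "\<exists>e\<in>{0, 1}. \<exists>f\<in>{0, 1}. corner e f = opp q"
      by (cases q) (simp_all add: corner_def)
    then obtain e f where ef: "e \<in> {0, 1}" "f \<in> {0, 1}" "corner e f = opp q" by blast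
    have div: "(2 * i + e) div 2 = i" "(2 * j + f) div 2 = j"
      "(2 * k + 1 - (2 * i + e)) div 2 = k - i" "(2 * l + 1 - (2 * j + f)) div 2 = l - j"
      using ef by auto
    have cor: "corner (2 * i + e) (2 * j + f) = opp q"
      "corner (2 * k + 1 - (2 * i + e)) (2 * l + 1 - (2 * j + f)) = q"
      using ef(1,2) arg_cong[OF ef(3), of opp] by (auto simp: corner_def)
    have "\<bar>2 * (2 * i + e) - (2 * k + 1)\<bar> \<le> 2 * r + 1"
      "\<bar>2 * (2 * j + f) - (2 * l + 1)\<bar> \<le> 2 * r + 1"
      using ef ij by auto
    then have "inflate g (2 * k + 1 - (2 * i + e)) (2 * l + 1 - (2 * j + f)) =
        opp (inflate g (2 * i + e) (2 * j + f))"
      using assms unfolding symmetric_within_def by blast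
    then show "child (g (k - i) (l - j)) q = child (opp (g i j)) q"
      unfolding inflate_def div cor by (metis child_opp opp_opp)
  qed
qed

text \<open>Each desubstitution turns radius 2r + 1 into r, hence the radii 2 ^ (m + 2) - 1. In the
  base case radius 3 allows two parity tests, which make the centre an even vertex. In general the
  centre is the vertex 2 ^ (m + 1) (v, w).\<close>

lemma symmetric_window:
  assumes "\<And>i. \<bar>2 * i - k\<bar> \<le> 2 ^ (m + 2) - 1 \<Longrightarrow> 0 \<le> i \<and> i < 2 ^ n"
    and "\<And>j. \<bar>2 * j - l\<bar> \<le> 2 ^ (m + 2) - 1 \<Longrightarrow> 0 \<le> j \<and> j < 2 ^ n"
    and "symmetric_within (2 ^ (m + 2) - 1) ((inflate ^^ n) (\<lambda>_ _. a)) k l"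
  shows "\<exists>v w. k + 1 = 2 ^ (m + 2) * v \<and> l + 1 = 2 ^ (m + 2) * w \<and>
    (\<forall>i j. - (2 ^ m) \<le> i \<and> i < 2 ^ m \<and> - (2 ^ m) \<le> j \<and> j < 2 ^ m \<longrightarrow>
      (inflate ^^ n) (\<lambda>_ _. a) (2 ^ (m + 1) * v + i) (2 ^ (m + 1) * w + j) =
      (inflate ^^ m) quadrant i j)"
  using assms
proof (induction m arbitrary: n k l)
  case 0
  let ?F = "\<lambda>n. (inflate ^^ n) (\<lambda>_ _. a)"
  have in_range: "0 \<le> i \<and> i < 2 ^ n" if "\<bar>2 * i - k\<bar> \<le> 3" for i using 0(1)[of i] that by simp
  have in_range': "0 \<le> j \<and> j < 2 ^ n" if "\<bar>2 * j - l\<bar> \<le> 3" for j using 0(2)[of j] that by simp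
  \<comment> \<open>Two window indices differ by 2, so the supertile has level at least 2 and both
    parity tests see an inflated pattern.\<close>
  have "(2::int) < 2 ^ n"
  proof -
    have "\<bar>2 * (k div 2 - 1) - k\<bar> \<le> 3" "\<bar>2 * (k div 2 + 1) - k\<bar> \<le> 3" by presburger+
    then show ?thesis using in_range[of "k div 2 - 1"] in_range[of "k div 2 + 1"] by linarith
  qed
  then have "n \<noteq> 0" "n \<noteq> 1" by (intro notI; simp)+
  then obtain n' where n: "n = Suc (Suc n')" by (metis One_nat_def not0_implies_Suc)
  have sym: "symmetric_within 3 (?F n) k l" using 0(3) by simp
  then have "odd k \<and> odd l" unfolding n by (auto dest: symmetric_within_odd)
  then obtain k' l' where kl: "k = 2 * k' + 1" "l = 2 * l' + 1" by (meson oddE)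
  then have "symmetric_within 1 (?F (Suc n')) k' l'"
    using symmetric_within_parent[of 1 "?F (Suc n')"] sym unfolding n by simp
  then have "odd k' \<and> odd l'" by (auto dest: symmetric_within_odd)
  then obtain v' w' where "k' = 2 * v' + 1" "l' = 2 * w' + 1" by (meson oddE)
  then obtain v w where vw: "k = 2 * (2 * v) - 1" "l = 2 * (2 * w) - 1"
    using kl that[of "v' + 1" "w' + 1"] by auto
  let ?h = "?F n"
  have s1: "?h (2 * v - 1) (2 * w - 1) = opp (?h (2 * v) (2 * w))"
    using sym[unfolded symmetric_within_def, rule_format, of "2 * v" "2 * w"]
    by (simp add: vw algebra_simps)
  have s2: "?h (2 * v) (2 * w - 1) = opp (?h (2 * v - 1) (2 * w))"
    using sym[unfolded symmetric_within_def, rule_format, of "2 * v - 1" "2 * w"]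
    by (simp add: vw algebra_simps)
  have "?h (2 * v) (2 * w) \<noteq> SW \<and> ?h (2 * v - 1) (2 * w) \<noteq> SE"
  proof (rule symmetric_vertex_not_inward[where n = n and a = a])
    show "0 < 2 * v" "2 * v < 2 ^ n" using in_range[of "2 * v - 1"] in_range[of "2 * v"] vw by auto
    show "0 < 2 * w" "2 * w < 2 ^ n" using in_range'[of "2 * w - 1"] in_range'[of "2 * w"] vw by auto
    show "?h (2 * v) (2 * w) = SW \<longleftrightarrow> ?h (2 * v - 1) (2 * w - 1) = NE"
      unfolding s1 by (cases "?h (2 * v) (2 * w)") auto
    show "?h (2 * v - 1) (2 * w) = SE \<longleftrightarrow> ?h (2 * v) (2 * w - 1) = NW"
      unfolding s2 by (cases "?h (2 * v - 1) (2 * w)") auto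
  qed (rule refl)
  \<comment> \<open>A child at an even vertex points either inward or outward; with inward excluded,
    two outward arrows remain and symmetry supplies the other two.\<close>
  moreover have "?h = inflate (?F (Suc n'))" by (simp add: n)
  ultimately have "?h (2 * v) (2 * w) = NE \<and> ?h (2 * v - 1) (2 * w) = NW"
    by (metis child_corners(2,4,6,8) inflate_double(1,2))
  then have star: "?h (2 * v) (2 * w) = NE" "?h (2 * v - 1) (2 * w) = NW"
    "?h (2 * v - 1) (2 * w - 1) = SW" "?h (2 * v) (2 * w - 1) = SE"
    using s1 s2 by simp_all
  have "?h (2 * v + i) (2 * w + j) = quadrant i j" if "- 1 \<le> i" "i < 1" "- 1 \<le> j" "j < 1" for i j
  proof -
    have "i = 0 \<or> i = - 1" "j = 0 \<or> j = - 1" using that by auto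
    then show ?thesis using star by (auto simp: quadrant_def)
  qed
  then show ?case using vw by (intro exI[of _ v] exI[of _ w]) auto
next
  case (Suc m)
  let ?F = "\<lambda>n. (inflate ^^ n) (\<lambda>_ _. a)"
  define R :: int where "R = 2 ^ (m + 2) - 1"
  have R: "2 ^ (Suc m + 2) - 1 = 2 * R + 1" by (simp add: R_def)
  have "(1::int) \<le> 2 ^ m" by simp
  then have "1 < 4 * (2::int) ^ m" by linarith
  then have R1: "1 \<le> R" by (simp add: R_def)
  have in_range: "0 \<le> i \<and> i < 2 ^ n" if "\<bar>2 * i - k\<bar> \<le> 2 * R + 1" for i
    using Suc.prems(1)[of i] that unfolding R .
  have in_range': "0 \<le> j \<and> j < 2 ^ n" if "\<bar>2 * j - l\<bar> \<le> 2 * R + 1" for j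
    using Suc.prems(2)[of j] that unfolding R .
  have "(1::int) < 2 ^ n"
  proof -
    have "\<bar>2 * (k div 2) - k\<bar> \<le> 1" "\<bar>2 * (k div 2 + 1) - k\<bar> \<le> 2" by presburger+
    moreover have "2 \<le> 2 * R + 1" using R1 by linarith
    ultimately show ?thesis using in_range[of "k div 2"] in_range[of "k div 2 + 1"] by linarith
  qed
  then have "n \<noteq> 0" by (intro notI) simp
  then obtain n' where n: "n = Suc n'" by (metis not0_implies_Suc)
  have sym: "symmetric_within (2 * R + 1) (inflate (?F n')) k l"
    using Suc.prems(3) unfolding R n by simp
  then have "odd k \<and> odd l" by (rule symmetric_within_odd) (use R1 in linarith)
  then obtain k' l' where kl: "k = 2 * k' + 1" "l = 2 * l' + 1" by (meson oddE)
  have "0 \<le> i \<and> i < 2 ^ n'" if "\<bar>2 * i - k'\<bar> \<le> R" for i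
    using in_range[of "2 * i"] that unfolding n kl by auto
  moreover have "0 \<le> j \<and> j < 2 ^ n'" if "\<bar>2 * j - l'\<bar> \<le> R" for j
    using in_range'[of "2 * j"] that unfolding n kl by auto
  ultimately obtain v w where vw: "k' + 1 = 2 ^ (m + 2) * v" "l' + 1 = 2 ^ (m + 2) * w"
    and eq: "\<And>i j. - (2 ^ m) \<le> i \<Longrightarrow> i < 2 ^ m \<Longrightarrow> - (2 ^ m) \<le> j \<Longrightarrow> j < 2 ^ m \<Longrightarrow>
      ?F n' (2 ^ (m + 1) * v + i) (2 ^ (m + 1) * w + j) = (inflate ^^ m) quadrant i j"
    using Suc.IH[folded R_def, OF _ _ symmetric_within_parent[OF sym[unfolded kl]]] by blast
  have "?F n (2 ^ (Suc m + 1) * v + i) (2 ^ (Suc m + 1) * w + j) = (inflate ^^ Suc m) quadrant i j"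
    if "- (2 ^ Suc m) \<le> i \<and> i < 2 ^ Suc m \<and> - (2 ^ Suc m) \<le> j \<and> j < 2 ^ Suc m" for i j
  proof -
    \<comment> \<open>The shift is even, so it passes through the halving and does not affect the
      corner.\<close>
    have "(2 ^ (Suc m + 1) * v + i) div 2 = 2 ^ (m + 1) * v + i div 2"
      "(2 ^ (Suc m + 1) * w + j) div 2 = 2 ^ (m + 1) * w + j div 2"
      by simp_all
    moreover have "corner (2 ^ (Suc m + 1) * v + i) (2 ^ (Suc m + 1) * w + j) = corner i j"
      by (simp add: corner_def)
    moreover have "?F n' (2 ^ (m + 1) * v + i div 2) (2 ^ (m + 1) * w + j div 2) =
        (inflate ^^ m) quadrant (i div 2) (j div 2)"
      using that by (intro eq) auto
    ultimately show ?thesis unfolding n by (simp add: inflate_def)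
  qed
  moreover have "k + 1 = 2 ^ (Suc m + 2) * v" "l + 1 = 2 ^ (Suc m + 2) * w" using kl vw by auto
  ultimately show ?case by blast
qed

section \<open>Centrally symmetric tilings\<close>

lemma Omega_patch:
  assumes "T \<in> Omega" "finite P" "P \<subseteq> T"
  obtains b n a where "P \<subseteq> cluster b ((inflate ^^ n) (\<lambda>_ _. a)) (block 0 (2 ^ n))"
proof -
  obtain t n v Q where Q: "Q \<subseteq> (subst ^^ n) {t}" "P = translate v Q"
    using assms unfolding Omega_def by blast
  obtain b where "(subst ^^ n) {t} = cluster b ((inflate ^^ n) (\<lambda>_ _. snd t)) (block 0 (2 ^ n))"
    using subst_pow_tile[of n "fst t" "snd t"] by auto
  then have "P \<subseteq> cluster (v + b) ((inflate ^^ n) (\<lambda>_ _. snd t)) (block 0 (2 ^ n))"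
    using translate_mono[OF Q(1), of v] by (simp add: Q(2) translate_cluster)
  then show ?thesis by (rule that)
qed

lemma Omega_functional:
  assumes "T \<in> Omega" "(c, a) \<in> T" "(c, a') \<in> T"
  shows "a = a'"
proof -
  obtain b n d where "{(c, a), (c, a')} \<subseteq> cluster b ((inflate ^^ n) (\<lambda>_ _. d)) (block 0 (2 ^ n))"
    by (rule Omega_patch[of T "{(c, a), (c, a')}"]) (use assms in auto)
  then show ?thesis by (auto dest: cluster_functional)
qed

text \<open>Two tiles already form a finite patch, so both lie in one translated supertile.\<close>

lemma Omega_lattice:
  assumes "T \<in> Omega" "(c, a) \<in> T" "(c', a') \<in> T"
  obtains i j where "c' = c + ivec i j"
proof -
  obtain b n d where "{(c, a), (c', a')} \<subseteq> cluster b ((inflate ^^ n) (\<lambda>_ _. d)) (block 0 (2 ^ n))"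
    by (rule Omega_patch[of T "{(c, a), (c', a')}"]) (use assms in auto)
  then obtain i j i' j' where "c = b + ivec i j" "c' = b + ivec i' j'"
    by (auto simp: cluster_def)
  then have "c' = c + ivec (i' - i) (j' - j)" by (simp add: vec_eq_iff forall_2)
  then show ?thesis by (rule that)
qed

lemma Omega_cluster:
  assumes T: "T \<in> Omega"
  obtains b f where "T = cluster b f UNIV"
proof -
  have cov: "(\<Union>t\<in>T. support t) = UNIV" using T by (simp add: Omega_def is_tiling_def)
  then obtain b a where ba: "(b, a) \<in> T" by fastforce
  define f where "f i j = (THE d. (b + ivec i j, d) \<in> T)" for i j
  have f: "f i j = d" if "(b + ivec i j, d) \<in> T" for i j d
    unfolding f_def using that Omega_functional[OF T] by blast
  have "(b + ivec i j, f i j) \<in> T" for i j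
  proof -
    obtain c d where cd: "(c, d) \<in> T" "b + ivec i j \<in> support (c, d)" using cov by fastforce
    obtain i' j' where c: "c = b + ivec i' j'" using Omega_lattice[OF T ba cd(1)] .
    \<comment> \<open>Centres in the same lattice that differ by at most 1/2 in each coordinate are
      equal.\<close>
    have "i' = i" "j' = j" using cd(2) unfolding c by (auto simp: support_iff)
    then show ?thesis using cd(1) f c by auto
  qed
  then have "cluster b f UNIV \<subseteq> T" by (auto simp: cluster_def)
  moreover have "T \<subseteq> cluster b f UNIV"
  proof
    fix t assume t: "t \<in> T"
    obtain i j where "fst t = b + ivec i j" using Omega_lattice[OF T ba, of "fst t" "snd t"] t by auto
    then have "t = (b + ivec i j, f i j)" using f[of i j "snd t"] t by (metis prod.collapse)
    then show "t \<in> cluster b f UNIV" using cluster_memI[of i j UNIV b f] by simp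
  qed
  ultimately show ?thesis using that by blast
qed

lemma act_tile_rot180: "act_tile rot180 (c, a) = (- c, opp a)"
  by (cases a) (simp_all add: act_tile_def act_arrow_simps,
    simp_all add: rot180_def vec_eq_iff forall_2 matrix_vector_mult_def sum_2)

text \<open>A finite window around the centre lies in a supertile, where
  \<open>symmetric_window\<close> applies. Although found for each \<open>m\<close> separately,
  \<open>p\<close> and \<open>q\<close> are determined by \<open>k\<close> and
  \<open>l\<close>.\<close>

lemma symmetric_cluster_window:
  assumes T: "cluster b f UNIV \<in> Omega" and sym: "\<And>i j. f (k - i) (l - j) = opp (f i j)"
  obtains p q where "k = 2 * p - 1" "l = 2 * q - 1"
    "\<And>i j. (i, j) \<in> block (- (2 ^ m)) (2 ^ m) \<Longrightarrow> f (p + i) (q + j) = (inflate ^^ m) quadrant i j"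
proof -
  define R :: int where "R = 2 ^ (m + 2) - 1"
  have "(1::int) \<le> 2 ^ m" "R = 4 * 2 ^ m - 1" by (simp_all add: R_def)
  then have R1: "1 \<le> R" and R2: "2 * 2 ^ m \<le> R" by linarith+
  define W where "W k = {i. \<bar>2 * i - k\<bar> \<le> R}" for k
  have "W k \<subseteq> {- (\<bar>k\<bar> + R) .. \<bar>k\<bar> + R}" for k by (auto simp: W_def)
  then have "finite (W k)" for k by (rule finite_subset) simp
  then have "finite (cluster b f (W k \<times> W l))" by (simp add: cluster_def)
  moreover have "cluster b f (W k \<times> W l) \<subseteq> cluster b f UNIV" by (auto simp: cluster_def)
  ultimately obtain b' n a where
    sub: "cluster b f (W k \<times> W l) \<subseteq> cluster b' ((inflate ^^ n) (\<lambda>_ _. a)) (block 0 (2 ^ n))"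
    by (rule Omega_patch[OF T])
  let ?h = "(inflate ^^ n) (\<lambda>_ _. a)"
  have mem: "(b + ivec i j, f i j) \<in> cluster b' ?h (block 0 (2 ^ n))" if "i \<in> W k" "j \<in> W l" for i j
    using sub cluster_memI[of i j "W k \<times> W l" b f] that by blast
  have "\<bar>2 * (k div 2) - k\<bar> \<le> 1" "\<bar>2 * (l div 2) - l\<bar> \<le> 1" by presburger+
  then have W0: "k div 2 \<in> W k" "l div 2 \<in> W l" using R1 by (auto simp: W_def)
  obtain x0 y0 where "b + ivec (k div 2) (l div 2) = b' + ivec x0 y0"
    using mem[OF W0] by (auto simp: cluster_def)
  \<comment> \<open>The shift from indices of the tiling to indices of the supertile; it moves the
    centre parameters to k + 2x and l + 2y.\<close>
  define x y where "x = x0 - k div 2" and "y = y0 - l div 2"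
  have b: "b = b' + ivec x y"
    using \<open>b + ivec (k div 2) (l div 2) = b' + ivec x0 y0\<close>
    by (simp add: vec_eq_iff forall_2 x_def y_def)
  have window: "i + x \<in> {0..<2 ^ n} \<and> j + y \<in> {0..<2 ^ n} \<and> f i j = ?h (i + x) (j + y)"
    if W: "i \<in> W k" "j \<in> W l" for i j
  proof -
    obtain i' j' where ij: "(i', j') \<in> block 0 (2 ^ n)"
      "(b + ivec i j, f i j) = (b' + ivec i' j', ?h i' j')"
      using mem[OF W] by (rule cluster_memE)
    then have "ivec (i + x) (j + y) = ivec i' j'" by (auto simp: b vec_eq_iff forall_2)
    then show ?thesis using ij by simp
  qed
  have "\<exists>v w. (k + 2 * x) + 1 = 2 ^ (m + 2) * v \<and> (l + 2 * y) + 1 = 2 ^ (m + 2) * w \<and>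
    (\<forall>i j. - (2 ^ m) \<le> i \<and> i < 2 ^ m \<and> - (2 ^ m) \<le> j \<and> j < 2 ^ m \<longrightarrow>
      ?h (2 ^ (m + 1) * v + i) (2 ^ (m + 1) * w + j) = (inflate ^^ m) quadrant i j)"
  proof (rule symmetric_window; fold R_def)
    show "0 \<le> i \<and> i < 2 ^ n" if "\<bar>2 * i - (k + 2 * x)\<bar> \<le> R" for i
      using window[of "i - x" "l div 2"] W0 that by (auto simp: W_def)
    show "0 \<le> j \<and> j < 2 ^ n" if "\<bar>2 * j - (l + 2 * y)\<bar> \<le> R" for j
      using window[of "k div 2" "j - y"] W0 that by (auto simp: W_def)
    show "symmetric_within R ?h (k + 2 * x) (l + 2 * y)"
      unfolding symmetric_within_def
    proof (intro allI impI)
      fix i j assume "\<bar>2 * i - (k + 2 * x)\<bar> \<le> R \<and> \<bar>2 * j - (l + 2 * y)\<bar> \<le> R"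
      then have "i - x \<in> W k" "j - y \<in> W l" "k - (i - x) \<in> W k" "l - (j - y) \<in> W l"
        by (auto simp: W_def)
      then have "?h i j = f (i - x) (j - y)"
        "?h (k - (i - x) + x) (l - (j - y) + y) = f (k - (i - x)) (l - (j - y))"
        using window by fastforce+
      then show "?h (k + 2 * x - i) (l + 2 * y - j) = opp (?h i j)"
        using sym[of "i - x" "j - y"] by (simp add: algebra_simps)
    qed
  qed
  then obtain v w where vw: "k + 2 * x + 1 = 2 ^ (m + 2) * v" "l + 2 * y + 1 = 2 ^ (m + 2) * w"
    and eq: "\<And>i j. (i, j) \<in> block (- (2 ^ m)) (2 ^ m) \<Longrightarrow>
      ?h (2 ^ (m + 1) * v + i) (2 ^ (m + 1) * w + j) = (inflate ^^ m) quadrant i j"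
    by auto
  define p q where "p = 2 ^ (m + 1) * v - x" and "q = 2 ^ (m + 1) * w - y"
  have kl: "k = 2 * p - 1" "l = 2 * q - 1" using vw by (auto simp: p_def q_def)
  have "f (p + i) (q + j) = (inflate ^^ m) quadrant i j" if ij: "(i, j) \<in> block (- (2 ^ m)) (2 ^ m)" for i j
  proof -
    have "p + i \<in> W k" "q + j \<in> W l" using ij R2 by (auto simp: W_def kl)
    then have "f (p + i) (q + j) = ?h (p + i + x) (q + j + y)" using window by blast
    also have "\<dots> = ?h (2 ^ (m + 1) * v + i) (2 ^ (m + 1) * w + j)"
      by (simp add: p_def q_def algebra_simps)
    finally show ?thesis using eq[OF ij] by simp
  qed
  then show ?thesis using that kl by blast
qed

lemma rot180_invariant_eq:
  assumes T: "T \<in> Omega" and inv: "act rot180 T = T"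
  shows "T = star_tiling"
proof -
  obtain b f where T_eq: "T = cluster b f UNIV" using T by (rule Omega_cluster)
  have rot: "(- c, opp a) \<in> T" if "(c, a) \<in> T" for c a
    using imageI[OF that, of "act_tile rot180"] inv by (simp add: act_def act_tile_rot180)
  have mem: "(b + ivec i j, f i j) \<in> T" for i j unfolding T_eq by (rule cluster_memI) simp
  \<comment> \<open>The rotated tile lies on the same lattice, so (k, l) = -2b is integral.\<close>
  obtain k l where kl: "- (b + ivec 0 0) = (b + ivec 0 0) + ivec k l"
    using Omega_lattice[OF T mem rot[OF mem]] by blast
  have sym: "f (k - i) (l - j) = opp (f i j)" for i j
  proof -
    have "- (b + ivec i j) = b + ivec (k - i) (l - j)"
      using kl by (auto simp: vec_eq_iff forall_2)
    then have "(b + ivec (k - i) (l - j), opp (f i j)) \<in> T" using rot[OF mem[of i j]] by simp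
    then show ?thesis using Omega_functional[OF T mem] by blast
  qed
  have "(subst ^^ m) outward_star \<subseteq> T" for m
  proof
    fix t assume "t \<in> (subst ^^ m) outward_star"
    then obtain i j where ij: "(i, j) \<in> block (- (2 ^ m)) (2 ^ m)"
      and t: "t = (half + ivec i j, (inflate ^^ m) quadrant i j)"
      unfolding subst_pow_star by (rule cluster_memE)
    obtain p q where pq: "k = 2 * p - 1" "l = 2 * q - 1"
      and eq: "\<And>i j. (i, j) \<in> block (- (2 ^ m)) (2 ^ m) \<Longrightarrow>
        f (p + i) (q + j) = (inflate ^^ m) quadrant i j"
      using symmetric_cluster_window[OF T[unfolded T_eq] sym] by metis
    \<comment> \<open>From -2b = (2p - 1, 2q - 1), the square with index (p, q) is centred at
      \<open>half\<close>, so its lower left corner is the origin.\<close>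
    have "half + ivec i j = b + ivec (p + i) (q + j)"
      using kl by (auto simp: vec_eq_iff forall_2 pq)
    then show "t \<in> T" using mem[of "p + i" "q + j"] eq[OF ij] by (simp add: t)
  qed
  then have "star_tiling \<subseteq> T" by (auto simp: star_tiling_def)
  moreover have "is_tiling T" using T by (simp add: Omega_def)
  ultimately show ?thesis using covering_subset_of_tiling_eq[OF star_tiling_covers] by blast
qed

section \<open>Subgroups containing the rotation by 180 degrees\<close>

lemma fixed_tilings_eq:
  assumes "rot180 \<in> H" "H \<subseteq> carrier O2Z"
  shows "fixed_tilings H = {star_tiling}"
  using assms star_tiling_Omega act_star_tiling rot180_invariant_eq
  unfolding fixed_tilings_def by blast

text \<open>For \<open>H4\<close> and \<open>H9\<close>: the reflections in two perpendicular lines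
  compose to the rotation by 180 degrees.\<close>

lemma rot180_in_generate:
  assumes "x \<in> S" "y \<in> S" "x ** y = rot180"
  shows "rot180 \<in> generate O2Z S"
  using generate.eng[OF generate.incl[OF assms(1)] generate.incl[OF assms(2)], of O2Z] assms(3)
  by (simp add: O2Z_def)

text \<open>A fixed point containing the star contains all its iterates, which already cover the
  plane.\<close>

lemma subst_fixed_eq_star_tiling:
  assumes "is_tiling T" "subst T = T" "outward_star \<subseteq> T"
  shows "T = star_tiling"
proof -
  have "(subst ^^ n) T = T" for n by (induction n) (simp_all add: assms(2))
  then have "star_tiling \<subseteq> T"
    unfolding star_tiling_def using subst_pow_mono[OF assms(3)] by fastforce
  then show ?thesis using covering_subset_of_tiling_eq[OF star_tiling_covers] assms(1) by blast
qed

theorem mainTheorem1: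
  shows "fixed_tilings H1 = fixed_tilings H2 \<and>
         fixed_tilings H2 = fixed_tilings H3 \<and>
         fixed_tilings H3 = fixed_tilings H4 \<and>
         fixed_tilings H4 = fixed_tilings H9 \<and>
         (\<exists>T0. fixed_tilings H1 = {T0} \<and>
               {T \<in> Omega. subst T = T \<and> touching_origin T = outward_star} = {T0})"
proof -
  interpret group O2Z by (rule O2Z_group)
  have "fixed_tilings H1 = {star_tiling}"
    by (rule fixed_tilings_eq) (auto simp: H1_def carrier_O2Z)
  moreover have "fixed_tilings H2 = {star_tiling}"
    by (rule fixed_tilings_eq) (auto simp: H2_eq carrier_O2Z)
  moreover have "fixed_tilings H3 = {star_tiling}"
    unfolding H3_def
    by (intro fixed_tilings_eq generate_incl generate.incl) (auto simp: carrier_O2Z)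
  moreover have "fixed_tilings H4 = {star_tiling}"
    unfolding H4_def
    by (intro fixed_tilings_eq generate_incl rot180_in_generate[of refl_x_axis _ refl_y_axis])
      (simp_all add: carrier_O2Z, simp add: O2Z_mats mat2_mult)
  moreover have "fixed_tilings H9 = {star_tiling}"
    unfolding H9_def
    by (intro fixed_tilings_eq generate_incl rot180_in_generate[of refl_diag _ refl_antidiag])
      (simp_all add: carrier_O2Z, simp add: O2Z_mats mat2_mult)
  moreover have "{T \<in> Omega. subst T = T \<and> touching_origin T = outward_star} = {star_tiling}"
  proof -
    have "T = star_tiling" if "T \<in> Omega" "subst T = T" "touching_origin T = outward_star" for T
      using that by (intro subst_fixed_eq_star_tiling) (auto simp: Omega_def touching_origin_def)
    then show ?thesis
      using star_tiling_Omega subst_star_tiling touching_origin_star_tiling by blast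
  qed
  ultimately show ?thesis by simp
qed

end
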